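(* Let $V$ be a digraph on $\mathcal N=\{1,\dots,N\}$ with real arc weights. Then the algebras $\aleph_k$ form an increasing sequence $$\{\mathcal N,\emptyset\}=\aleph_1\subseteq\aleph_2\subseteq\cdots\subseteq\aleph_{N-1}\subseteq\aleph_N=2^{\mathcal N},$$ where $2^{\mathcal N}$ is the set of all subsets of $\mathcal N$.
   Context: $V$ is a directed graph with vertex set $\mathcal N$, arc set $\mathcal A V\subseteq\mathcal N^2$, and real weights $v_{ij}$ on arcs $(i,j)$. A forest is a digraph without directed circuits (loops count as circuits) in which every vertex has outdegree $0$ or $1$; its trees are its weakly connected components; the root of a tree is its unique vertex of outdegree $0$. $\mathcal F^k(V)$ is the set of spanning subgraphs of $V$ that are forests with exactly $k$ trees; $\Sigma^F=\sum_{(i,j)\in\mathcal A F}v_{ij}$; $\varphi_k=\min_{F\in\mathcal F^k(V)}\Sigma^F$ ($+\infty$ if empty); $\tilde{\mathcal F}^k(V)=\{F\in\mathcal F^k(V):\Sigma^F=\varphi_k\}$. $\aleph_k$ is the algebra of subsets of $\mathcal N$ generated by the vertex sets of all trees of all forests $F\in\tilde{\mathcal F}^k(V)$ (the algebra generated by the empty family being $\{\emptyset,\mathcal N\}$). *)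

theory Defs
  imports
    "HOL-Analysis.Sigma_Algebra"
    "HOL-Library.Extended_Real"
    "Graph_Theory.Digraph_Component"
begin

text \<open>
  The library constant \<^const>\<open>forest\<close> only says that there are no directed circuits (a loop
  \<open>[(u,u)]\<close> is a \<^const>\<open>pre_digraph.cycle\<close>); the bound on the outdegrees is added here.
\<close>

definition rooted_forest :: "'a pair_pre_digraph \<Rightarrow> bool" where
  "rooted_forest F \<longleftrightarrow>
     forest (with_proj F) \<and> (\<forall>u\<in>pverts F. out_degree (with_proj F) u \<in> {0, 1})"

text \<open>
  Weakly connected components. \<^const>\<open>Digraph_Component.connected\<close> refers to the underlying
  undirected graph and, unlike its topological namesake, is false for the empty graph.
\<close>

definition trees :: "'a pair_pre_digraph \<Rightarrow> ('a, 'a \<times> 'a) pre_digraph set" where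
  "trees F = {T. pre_digraph.max_subgraph (with_proj F) Digraph_Component.connected T}"

definition forests :: "'a pair_pre_digraph \<Rightarrow> nat \<Rightarrow> 'a pair_pre_digraph set" where
  "forests V k =
     {F. spanning (with_proj F) (with_proj V) \<and> rooted_forest F \<and> card (trees F) = k}"

definition weight :: "('a \<Rightarrow> 'a \<Rightarrow> real) \<Rightarrow> 'a pair_pre_digraph \<Rightarrow> real" where
  "weight v F = (\<Sum>(i, j)\<in>parcs F. v i j)"

text \<open>
  On a finite digraph the infimum runs over a finite set, so it is a minimum; over the empty set
  it is \<open>\<infinity>\<close>.
\<close>

definition min_weight :: "'a pair_pre_digraph \<Rightarrow> ('a \<Rightarrow> 'a \<Rightarrow> real) \<Rightarrow> nat \<Rightarrow> ereal" where
  "min_weight V v k = (INF F\<in>forests V k. ereal (weight v F))"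

definition min_forests ::
  "'a pair_pre_digraph \<Rightarrow> ('a \<Rightarrow> 'a \<Rightarrow> real) \<Rightarrow> nat \<Rightarrow> 'a pair_pre_digraph set" where
  "min_forests V v k = {F \<in> forests V k. ereal (weight v F) = min_weight V v k}"

text \<open>
  \<^term>\<open>algebra \<Omega> hull G\<close> is the intersection of all algebras of subsets of \<open>\<Omega>\<close>
  that contain \<open>G\<close>.
\<close>

definition forest_algebra ::
  "'a pair_pre_digraph \<Rightarrow> ('a \<Rightarrow> 'a \<Rightarrow> real) \<Rightarrow> nat \<Rightarrow> 'a set set" where
  "forest_algebra V v k =
     algebra (pverts V) hull (\<Union>F\<in>min_forests V v k. verts ` trees F)"

end

theory Submission
  imports Defs
begin

text \<open>
  A forest in the sense of the theorem is a single-valued acyclic arc relation, and its trees are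
  the sets of vertices that flow into a common root. Let \<open>F\<close> and \<open>G\<close> be minimal with
  \<open>k\<close> and \<open>k + 1\<close> roots. If \<open>D\<close> is a union of trees of one of them, then swapping
  the arcs that start in \<open>D\<close> gives two forests of the same total weight and the same total
  number of roots; so both are minimal whenever their numbers of roots are again \<open>k\<close> and
  \<open>k + 1\<close>. Three such swaps turn \<open>G\<close> into a minimal forest with \<open>k + 1\<close> roots
  whose trees refine those of \<open>F\<close>. The first, on a tree of \<open>G\<close> without roots of \<open>F\<close>
  (which exists by the pigeonhole principle), makes the roots those of \<open>F\<close> and one new root
  \<open>q\<close>. The second restores \<open>F\<close> outside the tree \<open>T\<close> of \<open>F\<close> that contains
  \<open>q\<close>, which forces the new tree rooted at \<open>q\<close> into \<open>T\<close>. The third restores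
  \<open>F\<close> outside this new tree.
\<close>

section \<open>Forests as arc relations: roots, trees and arc swaps\<close>

definition branching :: "'a set \<Rightarrow> 'a rel \<Rightarrow> bool" where
  "branching P R \<longleftrightarrow> R \<subseteq> P \<times> P \<and> single_valued R \<and> acyclic R"

definition roots :: "'a set \<Rightarrow> 'a rel \<Rightarrow> 'a set" where
  "roots P R = P - Domain R"

text \<open>For a root \<open>r\<close> of a branching this is the vertex set of a whole weak
  component; for any other vertex it is only the part of the component that flows into
  \<open>r\<close>.\<close>

definition tree_of :: "'a rel \<Rightarrow> 'a \<Rightarrow> 'a set" where
  "tree_of R r = {u. (u, r) \<in> R\<^sup>*}"

definition redirect :: "'a rel \<Rightarrow> 'a set \<Rightarrow> 'a rel \<Rightarrow> 'a rel" where
  "redirect F D G = {(a, b) \<in> F. a \<notin> D} \<union> {(a, b) \<in> G. a \<in> D}"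

text \<open>No arc crosses the boundary of \<open>D\<close> in either direction. For a branching and
  \<open>D\<close> inside \<open>P\<close> this makes \<open>D\<close> a union of trees; the
  complement of a saturated set is saturated too.\<close>

definition saturated :: "'a rel \<Rightarrow> 'a set \<Rightarrow> bool" where
  "saturated R D \<longleftrightarrow> (\<forall>(a, b)\<in>R. a \<in> D \<longleftrightarrow> b \<in> D)"

lemma tree_of_self [simp]: "r \<in> tree_of R r"
  by (simp add: tree_of_def)

lemma roots_subset: "roots P R \<subseteq> P"
  by (auto simp: roots_def)

lemma finite_roots: "finite P \<Longrightarrow> finite (roots P R)"
  by (simp add: roots_def)

lemma redirect_Compl: "redirect F D G = redirect G (- D) F"
  by (auto simp: redirect_def)

lemma roots_redirect: "roots P (redirect F D G) = (roots P F - D) \<union> (roots P G \<inter> D)"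
  by (auto simp: roots_def redirect_def)

text \<open>A path that enters \<open>D\<close> continues along arcs of \<open>G\<close> and never
  leaves. Hence a cycle either lies in \<open>D\<close> and is a cycle of \<open>G\<close>, or
  avoids \<open>D\<close> and is a cycle of \<open>F\<close>.\<close>

lemma acyclic_redirect_closed:
  assumes "acyclic F" "acyclic G" and closed: "\<And>a b. (a, b) \<in> G \<Longrightarrow> a \<in> D \<Longrightarrow> b \<in> D"
  shows "acyclic (redirect F D G)"
proof (rule acyclicI, intro allI notI)
  let ?R = "redirect F D G"
  fix x assume cyc: "(x, x) \<in> ?R\<^sup>+"
  show False
  proof (cases "x \<in> D")
    case True
    have "y \<in> D \<and> (x, y) \<in> G\<^sup>+" if "(x, y) \<in> ?R\<^sup>+" for y
      using that
    proof induction
      case (base y)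
      with True closed show ?case by (auto simp: redirect_def)
    next
      case (step y z)
      then have "(y, z) \<in> G" by (auto simp: redirect_def)
      with step closed show ?case by (auto intro: trancl_into_trancl)
    qed
    with cyc assms(2) show False by (auto simp: acyclic_def)
  next
    case False
    have "y \<in> D \<or> (x, y) \<in> F\<^sup>+" if "(x, y) \<in> ?R\<^sup>+" for y
      using that
    proof induction
      case (base y)
      with False show ?case by (auto simp: redirect_def)
    next
      case (step y z)
      show ?case
      proof (cases "y \<in> D")
        case True
        with step closed show ?thesis by (auto simp: redirect_def)
      next
        case False
        with step show ?thesis by (auto simp: redirect_def intro: trancl_into_trancl)
      qed
    qed
    with cyc False assms(1) show False by (auto simp: acyclic_def)
  qed
qed

lemma acyclic_redirect:
  assumes "acyclic F" "acyclic G" "saturated F D \<or> saturated G D"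
  shows "acyclic (redirect F D G)"
proof (cases "saturated G D")
  case True
  then show ?thesis
    using assms by (intro acyclic_redirect_closed) (auto simp: saturated_def)
next
  case False
  \<comment> \<open>Here \<open>D\<close> is saturated for \<open>F\<close>, so \<open>- D\<close>
    is closed under the arcs of \<open>F\<close>, and the previous lemma applies with
    \<open>F\<close> and \<open>G\<close> exchanged.\<close>
  then show ?thesis
    unfolding redirect_Compl[of F D G]
    using assms by (intro acyclic_redirect_closed) (auto simp: saturated_def)
qed

lemma branching_redirect:
  assumes "branching P F" "branching P G" "saturated F D \<or> saturated G D"
  shows "branching P (redirect F D G)"
proof -
  have "single_valued (redirect F D G)"
    using assms(1,2) unfolding branching_def single_valued_def redirect_def by blast
  moreover have "redirect F D G \<subseteq> P \<times> P"
    using assms(1,2) by (auto simp: branching_def redirect_def)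
  ultimately show ?thesis
    using assms acyclic_redirect by (auto simp: branching_def)
qed

lemma branching_subset: "branching P R \<Longrightarrow> S \<subseteq> R \<Longrightarrow> branching P S"
  unfolding branching_def by (meson acyclic_subset single_valued_subset subset_trans)

lemma finite_branching: "finite P \<Longrightarrow> branching P R \<Longrightarrow> finite R"
  unfolding branching_def by (meson finite_SigmaI finite_subset)

text \<open>Following arcs from \<open>u\<close> must stop, because a finite acyclic relation has a
  well-founded converse; it stops at a root.\<close>

lemma root_exists:
  assumes "finite P" "branching P R" "u \<in> P"
  obtains r where "r \<in> roots P R" "u \<in> tree_of R r"
proof -
  have "wf (R\<inverse>)"
    using assms finite_branching by (auto simp: branching_def intro: finite_acyclic_wf_converse)
  then have "u \<in> P \<longrightarrow> (\<exists>r\<in>roots P R. u \<in> tree_of R r)"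
  proof (induction u rule: wf_induct_rule)
    case (less u)
    show ?case
    proof (cases "u \<in> Domain R")
      case True
      then obtain w where w: "(u, w) \<in> R" by auto
      with assms(2) have "w \<in> P" by (auto simp: branching_def)
      with less w obtain r where "r \<in> roots P R" "w \<in> tree_of R r" by auto
      with w show ?thesis by (auto simp: tree_of_def intro: converse_rtrancl_into_rtrancl)
    next
      case False
      then show ?thesis by (auto simp: roots_def intro!: bexI[of _ u])
    qed
  qed
  with assms(3) that show ?thesis by blast
qed

text \<open>In a single-valued relation, of two vertices reachable from \<open>u\<close> one is
  reachable from the other; no arc leaves a root, so two such roots coincide.\<close>

lemma root_unique:
  assumes "branching P R" "r \<in> roots P R" "s \<in> roots P R"
    and "u \<in> tree_of R r" "u \<in> tree_of R s"
  shows "r = s"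
proof -
  have "(r, s) \<in> R\<^sup>* \<or> (s, r) \<in> R\<^sup>*"
    using assms single_valued_confluent[of R u r s] by (auto simp: branching_def tree_of_def)
  with assms(2,3) show ?thesis
    by (auto simp: roots_def elim: converse_rtranclE)
qed

lemma roots_Int_tree_of:
  assumes "branching P R" "r \<in> roots P R"
  shows "roots P R \<inter> tree_of R r = {r}"
  using assms root_unique[OF assms(1)] by (auto intro: tree_of_self)

lemma tree_of_subset:
  assumes "branching P R" "r \<in> P"
  shows "tree_of R r \<subseteq> P"
  using assms by (auto simp: tree_of_def branching_def elim: converse_rtranclE)

lemma saturated_tree_of:
  assumes "branching P R" "r \<in> roots P R"
  shows "saturated R (tree_of R r)"
proof -
  have "b \<in> tree_of R r" if ab: "(a, b) \<in> R" and a: "a \<in> tree_of R r" for a b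
  proof -
    from a have "(a, r) \<in> R\<^sup>*" by (simp add: tree_of_def)
    then show ?thesis
    proof (cases rule: converse_rtranclE)
      case base
      with ab assms(2) show ?thesis by (auto simp: roots_def)
    next
      case (step y)
      with ab assms(1) have "y = b" by (auto simp: branching_def dest: single_valuedD)
      with step show ?thesis by (simp add: tree_of_def)
    qed
  qed
  then show ?thesis
    by (auto simp: saturated_def tree_of_def intro: converse_rtrancl_into_rtrancl)
qed

lemma saturated_rtrancl:
  assumes "saturated R D" "(a, b) \<in> R\<^sup>*"
  shows "a \<in> D \<longleftrightarrow> b \<in> D"
  using assms(2) by induction (use assms(1) in \<open>auto simp: saturated_def\<close>)

text \<open>A path to the root cannot leave a saturated set, so each vertex of \<open>S\<close> has
  its root in \<open>S\<close>, and each tree with its root in \<open>S\<close> lies in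
  \<open>S\<close>.\<close>

lemma saturated_eq_Union_trees:
  assumes "finite P" "branching P R" "saturated R S" "S \<subseteq> P"
  shows "S = (\<Union>r\<in>S \<inter> roots P R. tree_of R r)"
proof
  show "S \<subseteq> (\<Union>r\<in>S \<inter> roots P R. tree_of R r)"
  proof
    fix u assume u: "u \<in> S"
    with assms(4) root_exists[OF assms(1,2)] obtain r where "r \<in> roots P R" "u \<in> tree_of R r"
      by blast
    with u saturated_rtrancl[OF assms(3)] show "u \<in> (\<Union>r\<in>S \<inter> roots P R. tree_of R r)"
      by (auto simp: tree_of_def)
  qed
  show "(\<Union>r\<in>S \<inter> roots P R. tree_of R r) \<subseteq> S"
    using saturated_rtrancl[OF assms(3)] by (auto simp: tree_of_def)
qed

text \<open>The map \<open>g\<close> takes a vertex to its root in \<open>G\<close>. The image of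
  the roots of \<open>F\<close> is too small to cover the roots of \<open>G\<close>, and a root
  \<open>q\<close> that it misses has a tree without roots of \<open>F\<close>.\<close>

lemma tree_without_roots:
  assumes "finite P" "branching P F" "branching P G" "card (roots P F) < card (roots P G)"
  obtains q where "q \<in> roots P G" "roots P F \<inter> tree_of G q = {}"
proof -
  have "\<exists>r. r \<in> roots P G \<and> u \<in> tree_of G r" if "u \<in> P" for u
    using root_exists[OF assms(1,3) that] by metis
  then obtain g where g: "\<And>u. u \<in> P \<Longrightarrow> g u \<in> roots P G \<and> u \<in> tree_of G (g u)"
    by metis
  have "card (g ` roots P F) < card (roots P G)"
    using assms(4) card_image_le[OF finite_roots[OF assms(1)]] by (metis le_less_trans)
  then have "\<not> roots P G \<subseteq> g ` roots P F"
    using assms(1) by (metis card_mono finite_imageI finite_roots leD)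
  then obtain q where q: "q \<in> roots P G" "q \<notin> g ` roots P F" by blast
  have "roots P F \<inter> tree_of G q = {}"
    using g q root_unique[OF assms(3)] roots_subset[of P F] by blast
  with q that show ?thesis by blast
qed

section \<open>Minimal branchings and the exchange argument\<close>

locale weighted_arcs =
  fixes P :: "'a set" and A :: "'a rel" and v :: "'a \<Rightarrow> 'a \<Rightarrow> real"
  assumes fin: "finite P" and A_subset: "A \<subseteq> P \<times> P"
begin

definition branchings :: "nat \<Rightarrow> 'a rel set" where
  "branchings k = {R. R \<subseteq> A \<and> branching P R \<and> card (roots P R) = k}"

definition wt :: "'a rel \<Rightarrow> real" where
  "wt R = (\<Sum>(i, j)\<in>R. v i j)"

text \<open>Minimality by direct comparison keeps extended reals out of the exchange argument;
  \<open>forest_algebra_eq_hull\<close> links it to the infimum.\<close>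

definition min_branchings :: "nat \<Rightarrow> 'a rel set" where
  "min_branchings k = {R \<in> branchings k. \<forall>S\<in>branchings k. wt R \<le> wt S}"

lemma branchingsD:
  assumes "R \<in> branchings k"
  shows "branching P R" "R \<subseteq> A" "card (roots P R) = k" "finite R"
  using assms finite_branching[OF fin] by (auto simp: branchings_def)

lemma finite_branchings: "finite (branchings k)"
proof (rule finite_subset)
  show "branchings k \<subseteq> Pow (P \<times> P)"
    using A_subset by (auto simp: branchings_def)
qed (use fin in simp)

lemma min_branchings_nonempty:
  assumes "branchings k \<noteq> {}"
  shows "min_branchings k \<noteq> {}"
proof -
  from ex_min_if_finite[of "wt ` branchings k"] assms finite_branchings
  obtain R where "R \<in> branchings k" "\<And>S. S \<in> branchings k \<Longrightarrow> \<not> wt S < wt R" by auto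
  then have "R \<in> min_branchings k" by (auto simp: min_branchings_def not_less)
  then show ?thesis by blast
qed

text \<open>With fewer than \<open>card P\<close> roots some arc exists; deleting it turns its tail,
  and no other vertex, into a new root.\<close>

lemma branchings_Suc_nonempty:
  assumes "R \<in> branchings k" "k < card P"
  shows "branchings (Suc k) \<noteq> {}"
proof -
  note R = branchingsD[OF assms(1)]
  have "Domain R \<noteq> {}" using R(3) assms(2) by (auto simp: roots_def)
  then obtain a b where ab: "(a, b) \<in> R" by auto
  have "a \<in> P" using ab R(1) by (auto simp: branching_def)
  moreover have "c = b" if "(a, c) \<in> R" for c
    using that ab R(1) by (auto simp: branching_def dest: single_valuedD)
  ultimately have "roots P (R - {(a, b)}) = insert a (roots P R)"
    by (auto simp: roots_def)
  moreover have "a \<notin> roots P R" using ab by (auto simp: roots_def)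
  ultimately have "card (roots P (R - {(a, b)})) = Suc k"
    using R(3) fin by (simp add: finite_roots)
  then have "R - {(a, b)} \<in> branchings (Suc k)"
    using R branching_subset[OF R(1), of "R - {(a, b)}"] by (auto simp: branchings_def)
  then show ?thesis by blast
qed

text \<open>The swap and its counterpart distribute the arcs of \<open>F\<close> and
  \<open>G\<close> anew, split by whether the tail lies in \<open>D\<close>; each arc is counted as
  often as before.\<close>

lemma wt_redirect:
  assumes "finite F" "finite G"
  shows "wt (redirect F D G) + wt (redirect G D F) = wt F + wt G"
proof -
  let ?h = "\<lambda>(i, j). v i j"
  have split: "wt (redirect F' D G') = sum ?h {e \<in> F'. fst e \<notin> D} + sum ?h {e \<in> G'. fst e \<in> D}"
    if "finite F'" "finite G'" for F' G'
  proof -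
    have "redirect F' D G' = {e \<in> F'. fst e \<notin> D} \<union> {e \<in> G'. fst e \<in> D}"
      by (auto simp: redirect_def)
    then show ?thesis
      unfolding wt_def using that by (simp add: sum.union_disjoint disjoint_iff)
  qed
  have whole: "wt F' = sum ?h {e \<in> F'. fst e \<notin> D} + sum ?h {e \<in> F'. fst e \<in> D}"
    if "finite F'" for F'
  proof -
    have "redirect F' D F' = F'" by (auto simp: redirect_def)
    with split[OF that that] show ?thesis by simp
  qed
  show ?thesis
    using split[OF assms] split[OF assms(2,1)] whole[OF assms(1)] whole[OF assms(2)] by simp
qed

lemma card_roots_redirect:
  "card (roots P (redirect F D G)) + card (roots P (redirect G D F))
    = card (roots P F) + card (roots P G)"
proof -
  have redir: "card (roots P (redirect F' D G')) = card (roots P F' - D) + card (roots P G' \<inter> D)"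
    for F' G'
    unfolding roots_redirect using fin
    by (intro card_Un_disjoint) (auto simp: finite_roots)
  have split: "card (roots P F') = card (roots P F' - D) + card (roots P F' \<inter> D)" for F'
    using card_Int_Diff[OF finite_roots[OF fin], of F' D] by simp
  show ?thesis
    using redir[of F G] redir[of G F] split[of F] split[of G] by simp
qed

text \<open>The counterpart \<open>redirect G D F\<close> then has \<open>k\<close> roots, so it
  weighs at least as much as \<open>F\<close>. As the total weight is preserved,
  \<open>redirect F D G\<close> weighs at most as much as \<open>G\<close>.\<close>

lemma redirect_min_branching:
  assumes F: "F \<in> min_branchings k" and G: "G \<in> min_branchings l"
    and sat: "saturated F D \<or> saturated G D"
    and card: "card (roots P (redirect F D G)) = l"
  shows "redirect F D G \<in> min_branchings l"
proof -
  have F': "F \<in> branchings k" and G': "G \<in> branchings l"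
    using F G by (auto simp: min_branchings_def)
  note FD = branchingsD[OF F'] and GD = branchingsD[OF G']
  have sub: "redirect F D G \<subseteq> A" "redirect G D F \<subseteq> A"
    using FD(2) GD(2) by (auto simp: redirect_def)
  have 1: "redirect F D G \<in> branchings l"
    using sub card branching_redirect[OF FD(1) GD(1) sat] by (simp add: branchings_def)
  have "card (roots P (redirect G D F)) = k"
    using card_roots_redirect[of F D G] card FD(3) GD(3) by simp
  then have "redirect G D F \<in> branchings k"
    using sub branching_redirect[OF GD(1) FD(1)] sat by (auto simp: branchings_def)
  then have "wt F \<le> wt (redirect G D F)" using F by (simp add: min_branchings_def)
  with wt_redirect[OF FD(4) GD(4), of D] have "wt (redirect F D G) \<le> wt G" by simp
  with 1 G show ?thesis by (force simp: min_branchings_def)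
qed

text \<open>By \<open>saturated_eq_Union_trees\<close> the conclusion makes every tree of
  \<open>F\<close> a union of trees of \<open>H\<close>, which is what the inclusion of the algebras
  needs.\<close>

lemma refinement:
  assumes F: "F \<in> min_branchings k" and k: "k < card P"
  obtains H where "H \<in> min_branchings (Suc k)"
    "\<And>r. r \<in> roots P F \<Longrightarrow> saturated H (tree_of F r)"
proof -
  let ?rF = "roots P F"
  have F': "F \<in> branchings k" using F by (simp add: min_branchings_def)
  note FD = branchingsD[OF F']
  obtain G where G: "G \<in> min_branchings (Suc k)"
    using min_branchings_nonempty[OF branchings_Suc_nonempty[OF F' k]] by blast
  then have GD: "branching P G" "card (roots P G) = Suc k"
    by (auto simp: min_branchings_def dest: branchingsD)
  obtain q where q: "q \<in> roots P G" and disj: "?rF \<inter> tree_of G q = {}"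
    using tree_without_roots[OF fin FD(1) GD(1)] FD(3) GD(2) by auto
  have q_notin: "q \<notin> ?rF" using disj by (meson disjoint_iff tree_of_self)
  have qP: "q \<in> P" using q by (simp add: roots_def)
  have card: "card (insert q ?rF) = Suc k"
    using q_notin FD(3) by (simp add: finite_roots fin)

  define G0 where "G0 = redirect F (tree_of G q) G"
  \<comment> \<open>The swapped tree contains no root of \<open>F\<close>, so none is lost, and
    \<open>q\<close> is the only root of \<open>G\<close> in it.\<close>
  have rG0: "roots P G0 = insert q ?rF"
    unfolding G0_def roots_redirect using disj roots_Int_tree_of[OF GD(1) q] by blast
  have G0: "G0 \<in> min_branchings (Suc k)"
    using redirect_min_branching[OF F G] saturated_tree_of[OF GD(1) q] rG0 card
    by (simp add: G0_def)

  obtain t where t: "t \<in> ?rF" and qt: "q \<in> tree_of F t"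
    using root_exists[OF fin FD(1) qP] by blast
  let ?T = "tree_of F t"
  note satT = saturated_tree_of[OF FD(1) t]
  define G1 where "G1 = redirect F ?T G0"
  \<comment> \<open>Restoring \<open>F\<close> outside \<open>?T\<close> keeps the new root because
    \<open>q\<close> lies in \<open>?T\<close>.\<close>
  have rG1: "roots P G1 = insert q ?rF"
    unfolding G1_def roots_redirect rG0 using qt by blast
  have G1: "G1 \<in> min_branchings (Suc k)"
    using redirect_min_branching[OF F G0] satT rG1 card by (simp add: G1_def)
  then have G1D: "branching P G1"
    by (auto simp: min_branchings_def dest: branchingsD)

  let ?Q = "tree_of G1 q"
  have q1: "q \<in> roots P G1" using rG1 by simp
  have satQ: "saturated G1 ?Q" by (rule saturated_tree_of[OF G1D q1])
  \<comment> \<open>Going back along a path to \<open>q\<close>, an arc into \<open>?T\<close> from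
    outside would be an arc of \<open>F\<close>, and no arc of \<open>F\<close> crosses the boundary
    of \<open>?T\<close>.\<close>
  have QT: "?Q \<subseteq> ?T"
  proof
    fix u assume "u \<in> ?Q"
    then have "(u, q) \<in> G1\<^sup>*" by (simp add: tree_of_def)
    then show "u \<in> ?T"
    proof (induction rule: converse_rtrancl_induct)
      case base
      show ?case by (rule qt)
    next
      case (step y z)
      with satT show ?case by (auto simp: G1_def redirect_def saturated_def)
    qed
  qed
  define H where "H = redirect F ?Q G1"
  \<comment> \<open>No root of \<open>F\<close> lies in \<open>?Q\<close>: it would also be a root
    of \<open>G1\<close>, and \<open>q\<close> is the only one there.\<close>
  have "roots P H = insert q ?rF"
    unfolding H_def roots_redirect
    using roots_Int_tree_of[OF G1D q1] rG1 q_notin by blast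
  then have "H \<in> min_branchings (Suc k)"
    using redirect_min_branching[OF F G1] satQ card by (simp add: H_def)
  moreover have "saturated H (tree_of F r)" if r: "r \<in> ?rF" for r
    unfolding saturated_def
  proof clarify
    fix a b assume "(a, b) \<in> H"
    then consider "(a, b) \<in> F" | "(a, b) \<in> G1" "a \<in> ?Q"
      by (auto simp: H_def redirect_def)
    then show "a \<in> tree_of F r \<longleftrightarrow> b \<in> tree_of F r"
    proof cases
      case 1
      then show ?thesis using saturated_tree_of[OF FD(1) r] by (auto simp: saturated_def)
    next
      case 2
      \<comment> \<open>Such an arc stays inside \<open>?Q\<close> and hence inside the single tree
        \<open>?T\<close>, which is either \<open>tree_of F r\<close> or disjoint from it.\<close>
      then have "a \<in> ?T" "b \<in> ?T" using QT satQ by (auto simp: saturated_def)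
      then show ?thesis using root_unique[OF FD(1) r t] by blast
    qed
  qed
  ultimately show ?thesis using that by blast
qed

definition tree_sets :: "nat \<Rightarrow> 'a set set" where
  "tree_sets k = (\<Union>R\<in>min_branchings k. tree_of R ` roots P R)"

end

section \<open>Translation between digraph forests and branchings\<close>

lemma forest_iff_acyclic:
  assumes "pair_wf_digraph F"
  shows "forest (with_proj F) \<longleftrightarrow> acyclic (parcs F)"
proof -
  interpret pair_wf_digraph F by fact
  have "(\<exists>p. cycle p) \<longleftrightarrow> (\<exists>u. (u, u) \<in> (parcs F)\<^sup>+)"
  proof
    assume "\<exists>p. cycle p"
    then show "\<exists>u. (u, u) \<in> (parcs F)\<^sup>+"
      unfolding cycle_def using reachable1_awalk by blast
  next
    assume "\<exists>u. (u, u) \<in> (parcs F)\<^sup>+"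
    then show "\<exists>p. cycle p"
      using closed_w_imp_cycle unfolding closed_w_def reachable1_awalk by auto
  qed
  then show ?thesis by (auto simp: forest_def acyclic_def)
qed

lemma rooted_forest_iff_branching:
  assumes "pair_wf_digraph F" "finite (parcs F)"
  shows "rooted_forest F \<longleftrightarrow> branching (pverts F) (parcs F)"
proof -
  have sub: "parcs F \<subseteq> pverts F \<times> pverts F"
    using assms(1) by (auto simp: pair_wf_digraph_def)
  have deg: "out_degree (with_proj F) u \<in> {0, 1} \<longleftrightarrow>
      (\<forall>b c. (u, b) \<in> parcs F \<longrightarrow> (u, c) \<in> parcs F \<longrightarrow> b = c)" for u
  proof -
    let ?O = "out_arcs (with_proj F) u"
    \<comment> \<open>Finiteness matters because \<open>card\<close> of an infinite set is 0, which
      would pass as outdegree 0.\<close>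
    have "finite ?O" using assms(2) by (auto simp: out_arcs_def)
    then have "out_degree (with_proj F) u \<in> {0, 1} \<longleftrightarrow> (\<forall>d\<in>?O. \<forall>e\<in>?O. d = e)"
      unfolding out_degree_def using card_le_Suc0_iff_eq[of ?O] by (auto simp: le_Suc_eq)
    then show ?thesis by (auto simp: out_arcs_def)
  qed
  have "(\<forall>u\<in>pverts F. out_degree (with_proj F) u \<in> {0, 1}) \<longleftrightarrow> single_valued (parcs F)"
    unfolding deg single_valued_def using sub by blast
  with sub show ?thesis
    by (auto simp: rooted_forest_def branching_def forest_iff_acyclic[OF assms(1)])
qed

text \<open>This form of weak connectedness, by paths in the symmetric closure, makes
  \<open>saturated_rtrancl\<close> applicable.\<close>

lemma connected_iff_rtrancl:
  assumes "wf_digraph H"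
  shows "Digraph_Component.connected H \<longleftrightarrow>
    verts H \<noteq> {} \<and> (\<forall>a\<in>verts H. \<forall>b\<in>verts H. (a, b) \<in> (arcs_ends H \<union> (arcs_ends H)\<inverse>)\<^sup>*)"
proof -
  interpret wf_digraph H by fact
  interpret S: pair_wf_digraph "mk_symmetric H" ..
  have "parcs (mk_symmetric H) = arcs_ends H \<union> (arcs_ends H)\<inverse>"
    by (auto simp: parcs_mk_symmetric arcs_ends_conv)
  then show ?thesis
    by (auto simp: Digraph_Component.connected_def strongly_connected_def S.reachable_conv')
qed

text \<open>A tree is saturated for the arcs in both directions, so an undirected path that starts
  in it cannot leave it.\<close>

lemma connected_subgraph_in_tree_of:
  assumes F: "pair_wf_digraph F" "finite (pverts F)" "branching (pverts F) (parcs F)"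
    and T: "subgraph T (with_proj F)" "Digraph_Component.connected T"
  obtains r where "r \<in> roots (pverts F) (parcs F)" "verts T \<subseteq> tree_of (parcs F) r"
proof -
  have wf: "wf_digraph T" using T(1) by auto
  obtain u where u: "u \<in> verts T"
    using T(2) unfolding connected_iff_rtrancl[OF wf] by blast
  then have "u \<in> pverts F" using T(1) subgraph_imp_subverts by fastforce
  then obtain r where r: "r \<in> roots (pverts F) (parcs F)" "u \<in> tree_of (parcs F) r"
    using root_exists[OF F(2,3)] by blast
  have "verts T \<subseteq> tree_of (parcs F) r"
  proof
    fix w assume "w \<in> verts T"
    with u T(2) have "(u, w) \<in> (arcs_ends T \<union> (arcs_ends T)\<inverse>)\<^sup>*"
      unfolding connected_iff_rtrancl[OF wf] by blast
    moreover have "saturated (arcs_ends T \<union> (arcs_ends T)\<inverse>) (tree_of (parcs F) r)"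
      using saturated_tree_of[OF F(3) r(1)] arcs_ends_mono[OF T(1)]
      by (auto simp: saturated_def)
    ultimately show "w \<in> tree_of (parcs F) r"
      using saturated_rtrancl r(2) by metis
  qed
  with r(1) that show ?thesis by blast
qed

text \<open>Each vertex has a directed path to \<open>r\<close> whose vertices all lie in the tree;
  two vertices are joined through \<open>r\<close>.\<close>

lemma connected_induce_tree_of:
  assumes F: "pair_wf_digraph F" "branching (pverts F) (parcs F)"
    and r: "r \<in> roots (pverts F) (parcs F)"
  shows "Digraph_Component.connected (with_proj F \<restriction> tree_of (parcs F) r)"
proof -
  interpret pair_wf_digraph F by fact
  let ?T = "tree_of (parcs F) r" and ?H = "with_proj F \<restriction> tree_of (parcs F) r"
  have "?T \<subseteq> pverts F"
    using tree_of_subset[OF F(2)] r by (auto simp: roots_def)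
  then have wf: "wf_digraph ?H" by (intro wellformed_induce_subgraph)
  let ?S = "arcs_ends ?H \<union> (arcs_ends ?H)\<inverse>"
  have "(u, r) \<in> ?S\<^sup>*" if "u \<in> ?T" for u
  proof -
    from that have "(u, r) \<in> (parcs F)\<^sup>*" by (simp add: tree_of_def)
    then show ?thesis
    proof (induction rule: converse_rtrancl_induct)
      case (step y z)
      then have "(y, z) \<in> arcs_ends ?H"
        by (force simp: arcs_ends_conv tree_of_def intro: converse_rtrancl_into_rtrancl)
      with step show ?case by (auto intro: converse_rtrancl_into_rtrancl)
    qed simp
  qed
  moreover have "sym (?S\<^sup>*)" by (intro sym_rtrancl) (auto simp: sym_def)
  ultimately have "(a, b) \<in> ?S\<^sup>*" if "a \<in> ?T" "b \<in> ?T" for a b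
    using that by (meson rtrancl_trans symD)
  then show ?thesis
    unfolding connected_iff_rtrancl[OF wf] using tree_of_self by fastforce
qed

text \<open>The weak components are indexed by roots, which yields both their vertex sets
  (\<open>verts_trees\<close>) and their number (\<open>card_trees\<close>).\<close>

lemma trees_eq_induce_tree_of:
  assumes F: "pair_wf_digraph F" "finite (pverts F)" "branching (pverts F) (parcs F)"
  shows "trees F = (\<lambda>r. with_proj F \<restriction> tree_of (parcs F) r) ` roots (pverts F) (parcs F)"
proof -
  interpret pair_wf_digraph F by fact
  let ?rs = "roots (pverts F) (parcs F)" and ?H = "\<lambda>r. with_proj F \<restriction> tree_of (parcs F) r"
  have induced: "induced_subgraph (?H r) (with_proj F)" if "r \<in> ?rs" for r
    using tree_of_subset[OF F(3)] that by (intro induced_induce) (auto simp: roots_def)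
  have "T \<in> ?H ` ?rs" if "max_subgraph Digraph_Component.connected T" for T
  proof -
    have T: "subgraph T (with_proj F)" "Digraph_Component.connected T"
      using that by (auto simp: max_subgraph_def)
    then obtain r where r: "r \<in> ?rs" "verts T \<subseteq> tree_of (parcs F) r"
      using connected_subgraph_in_tree_of[OF F] by blast
    have wf: "wf_digraph T" and TF: "tail T = fst" "head T = snd" "arcs T \<subseteq> parcs F"
      using T(1) by (auto simp: subgraph_def compatible_def)
    have "arcs T \<subseteq> arcs (?H r)"
      using TF r(2) wf_digraph.wellformed[OF wf] by auto
    moreover have "wf_digraph (?H r)"
      using induced_imp_subgraph[OF induced[OF r(1)]] by (simp add: subgraph_def)
    \<comment> \<open>Since the induced graph is itself connected, maximality of \<open>T\<close>
      turns this inclusion into equality.\<close>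
    ultimately have "subgraph T (?H r)"
      using r(2) wf TF by (simp add: subgraph_def compatible_def)
    with that induced_imp_subgraph[OF induced[OF r(1)]] connected_induce_tree_of[OF F(1,3) r(1)]
    have "?H r = T" unfolding max_subgraph_def by blast
    with r(1) show ?thesis by blast
  qed
  moreover have "max_subgraph Digraph_Component.connected (?H r)" if r: "r \<in> ?rs" for r
    unfolding max_subgraph_def
  proof (intro conjI allI impI notI)
    show "subgraph (?H r) (with_proj F)" by (rule induced_imp_subgraph[OF induced[OF r]])
    show "Digraph_Component.connected (?H r)" by (rule connected_induce_tree_of[OF F(1,3) r])
    fix T assume T: "T \<noteq> ?H r \<and> subgraph (?H r) T"
      "subgraph T (with_proj F) \<and> Digraph_Component.connected T"
    then obtain s where s: "s \<in> ?rs" "verts T \<subseteq> tree_of (parcs F) s"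
      using connected_subgraph_in_tree_of[OF F] by blast
    have "tree_of (parcs F) r \<subseteq> verts T" using T(1) by (metis induce_subgraph_verts subgraph_imp_subverts)
    \<comment> \<open>The root \<open>r\<close> lies in both trees, so \<open>T\<close> cannot have
      more vertices than the tree of \<open>r\<close>; nor can it have more arcs than the induced
      subgraph.\<close>
    moreover from this s(2) have "r = s"
      using root_unique[OF F(3) r s(1), of r] tree_of_self[of r "parcs F"] by blast
    ultimately have V: "verts T = tree_of (parcs F) r" using s(2) by simp
    have wf: "wf_digraph T" and TF: "tail T = fst" "head T = snd" "arcs T \<subseteq> parcs F"
      and "arcs (?H r) \<subseteq> arcs T"
      using T by (auto simp: subgraph_def compatible_def)
    moreover have "arcs T \<subseteq> arcs (?H r)"
      using TF wf_digraph.wellformed[OF wf] V by auto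
    ultimately have "T = ?H r"
      using V by (intro pre_digraph.equality) auto
    with T(1) show False by simp
  qed
  ultimately show ?thesis by (auto simp: trees_def)
qed

lemma verts_trees:
  assumes "pair_wf_digraph F" "finite (pverts F)" "branching (pverts F) (parcs F)"
  shows "verts ` trees F = tree_of (parcs F) ` roots (pverts F) (parcs F)"
  unfolding trees_eq_induce_tree_of[OF assms] by (simp add: image_image)

lemma card_trees:
  assumes "pair_wf_digraph F" "finite (pverts F)" "branching (pverts F) (parcs F)"
  shows "card (trees F) = card (roots (pverts F) (parcs F))"
  unfolding trees_eq_induce_tree_of[OF assms]
proof (rule card_image, rule inj_onI)
  fix r s assume rs: "r \<in> roots (pverts F) (parcs F)" "s \<in> roots (pverts F) (parcs F)"
    and "with_proj F \<restriction> tree_of (parcs F) r = with_proj F \<restriction> tree_of (parcs F) s"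
  then have "tree_of (parcs F) r = tree_of (parcs F) s"
    by (metis induce_subgraph_verts)
  then show "r = s"
    using root_unique[OF assms(3) rs, of r] tree_of_self[of r "parcs F"] by simp
qed

lemma forests_eq_branchings:
  assumes "pair_wf_digraph V" "finite (pverts V)"
  shows "F \<in> forests V k \<longleftrightarrow>
    pverts F = pverts V \<and> parcs F \<in> weighted_arcs.branchings (pverts V) (parcs V) k"
proof -
  have A: "parcs V \<subseteq> pverts V \<times> pverts V"
    using assms(1) by (auto simp: pair_wf_digraph_def)
  interpret weighted_arcs "pverts V" "parcs V"
    using assms(2) A by unfold_locales
  have spanning: "spanning (with_proj F) (with_proj V) \<longleftrightarrow>
      pverts F = pverts V \<and> parcs F \<subseteq> parcs V \<and> pair_wf_digraph F"
    using assms(1) by (auto simp: spanning_def subgraph_def wf_digraph_wp_iff)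
  have wf: "pair_wf_digraph F" if "pverts F = pverts V" "parcs F \<subseteq> parcs V"
    using that A by (auto simp: pair_wf_digraph_def)
  have "rooted_forest F \<and> card (trees F) = k \<longleftrightarrow>
      branching (pverts V) (parcs F) \<and> card (roots (pverts V) (parcs F)) = k"
    if "pverts F = pverts V" "parcs F \<subseteq> parcs V"
  proof -
    have "finite (parcs F)"
      using that(2) A assms(2) by (meson finite_SigmaI finite_subset)
    then show ?thesis
      using rooted_forest_iff_branching[OF wf[OF that]] card_trees[OF wf[OF that]] assms(2) that(1)
      by auto
  qed
  then show ?thesis
    unfolding forests_def branchings_def mem_Collect_eq spanning using wf by blast
qed

lemma algebra_hull:
  assumes "G \<subseteq> Pow \<Omega>"
  shows "algebra \<Omega> (algebra \<Omega> hull G)"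
proof -
  \<comment> \<open>Some algebra contains \<open>G\<close>, so the hull is not the intersection of
    an empty family, which would be \<open>UNIV\<close>.\<close>
  have "algebra \<Omega> (Pow \<Omega>)" by (rule algebra_Pow)
  then show ?thesis
    using assms unfolding hull_def algebra_iff_Un by auto
qed

lemma forest_algebra_eq_hull:
  fixes v :: "'a \<Rightarrow> 'a \<Rightarrow> real"
  assumes "pair_wf_digraph V" "finite (pverts V)"
  shows "forest_algebra V v k =
    algebra (pverts V) hull weighted_arcs.tree_sets (pverts V) (parcs V) v k"
proof -
  have A: "parcs V \<subseteq> pverts V \<times> pverts V"
    using assms(1) by (auto simp: pair_wf_digraph_def)
  interpret weighted_arcs "pverts V" "parcs V" v
    using assms(2) A by unfold_locales
  note forests = forests_eq_branchings[OF assms]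
  have weight: "weight v F = wt (parcs F)" for F
    by (simp add: weight_def wt_def)
  have min: "F \<in> min_forests V v k \<longleftrightarrow> pverts F = pverts V \<and> parcs F \<in> min_branchings k" for F
  proof -
    have "F \<in> min_forests V v k \<longleftrightarrow> F \<in> forests V k \<and> (\<forall>H\<in>forests V k. weight v F \<le> weight v H)"
    proof -
      have "ereal (weight v F) = min_weight V v k \<longleftrightarrow> (\<forall>H\<in>forests V k. weight v F \<le> weight v H)"
        if F: "F \<in> forests V k"
      proof -
        \<comment> \<open>The infimum is always at most the weight of \<open>F\<close>, so attaining
          it amounts to being a lower bound of all weights.\<close>
        have "min_weight V v k \<le> ereal (weight v F)"
          unfolding min_weight_def by (rule INF_lower[OF F])
        then have "ereal (weight v F) = min_weight V v k \<longleftrightarrow> ereal (weight v F) \<le> min_weight V v k"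
          by auto
        then show ?thesis by (simp add: min_weight_def le_INF_iff)
      qed
      then show ?thesis by (auto simp: min_forests_def)
    qed
    also have "\<dots> \<longleftrightarrow> pverts F = pverts V \<and> parcs F \<in> branchings k \<and>
        (\<forall>S\<in>branchings k. wt (parcs F) \<le> wt S)"
    proof -
      \<comment> \<open>Every \<open>S\<close> in \<open>branchings k\<close> is the arc set of a
        forest, namely of the record with vertex set \<open>pverts V\<close>.\<close>
      have "(\<forall>H\<in>forests V k. weight v F \<le> weight v H) \<longleftrightarrow>
          (\<forall>S\<in>branchings k. wt (parcs F) \<le> wt S)"
        unfolding weight
        by (metis forests pair_pre_digraph.select_convs)
      then show ?thesis by (auto simp: forests)
    qed
    finally show ?thesis by (simp add: min_branchings_def)
  qed
  have verts: "verts ` trees F = tree_of (parcs F) ` roots (pverts V) (parcs F)"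
    if "pverts F = pverts V" "parcs F \<in> min_branchings k" for F
  proof -
    have "parcs F \<subseteq> parcs V" "branching (pverts V) (parcs F)"
      using that(2) by (auto simp: min_branchings_def dest: branchingsD)
    with that(1) A have "pair_wf_digraph F" by (auto simp: pair_wf_digraph_def)
    with verts_trees[of F] that(1) assms(2) \<open>branching _ _\<close> show ?thesis by simp
  qed
  have "(\<Union>F\<in>min_forests V v k. verts ` trees F) = tree_sets k"
  proof
    show "(\<Union>F\<in>min_forests V v k. verts ` trees F) \<subseteq> tree_sets k"
    proof (rule UN_least)
      fix F assume "F \<in> min_forests V v k"
      then have "pverts F = pverts V" "parcs F \<in> min_branchings k" using min by simp_all
      with verts show "verts ` trees F \<subseteq> tree_sets k" unfolding tree_sets_def by blast
    qed
    show "tree_sets k \<subseteq> (\<Union>F\<in>min_forests V v k. verts ` trees F)"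
    proof
      fix S assume "S \<in> tree_sets k"
      then obtain R where R: "R \<in> min_branchings k" "S \<in> tree_of R ` roots (pverts V) R"
        by (auto simp: tree_sets_def)
      let ?F = "\<lparr>pverts = pverts V, parcs = R\<rparr>"
      have "?F \<in> min_forests V v k" "S \<in> verts ` trees ?F"
        using R min[of ?F] verts[of ?F] by simp_all
      then show "S \<in> (\<Union>F\<in>min_forests V v k. verts ` trees F)" by blast
    qed
  qed
  then show ?thesis by (simp add: forest_algebra_def)
qed

section \<open>The increasing chain of algebras\<close>

context weighted_arcs
begin

lemma tree_sets_subset: "tree_sets k \<subseteq> Pow P"
proof -
  have "tree_of R r \<subseteq> P" if "R \<in> min_branchings k" "r \<in> roots P R" for R r
    using that tree_of_subset branchingsD(1) by (fastforce simp: min_branchings_def roots_def)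
  then show ?thesis by (auto simp: tree_sets_def)
qed

lemma algebra_tree_sets: "algebra P (algebra P hull tree_sets k)"
  by (rule algebra_hull[OF tree_sets_subset])

text \<open>A single root collects every vertex, so the only possible generator is \<open>P\<close>.
  If no branching has exactly one root, there are no generators and the hull is again
  trivial.\<close>

lemma hull_tree_sets_1:
  assumes "P \<noteq> {}"
  shows "algebra P hull tree_sets 1 = {P, {}}"
proof
  have "S = P" if "S \<in> tree_sets 1" for S
  proof -
    from that obtain R r where R: "R \<in> branchings 1" and r: "r \<in> roots P R" and S: "S = tree_of R r"
      by (auto simp: tree_sets_def min_branchings_def)
    note RD = branchingsD[OF R]
    from RD(3) r have "roots P R = {r}" by (auto simp: card_1_singleton_iff)
    then have "P \<subseteq> tree_of R r" using root_exists[OF fin RD(1)] by (metis singletonD subsetI)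
    with S tree_of_subset[OF RD(1)] r show ?thesis by (auto simp: roots_def)
  qed
  moreover have "algebra P {P, {}}" by (auto simp: algebra_iff_Un)
  ultimately show "algebra P hull tree_sets 1 \<subseteq> {P, {}}"
    by (intro hull_minimal) auto
  interpret B: algebra P "algebra P hull tree_sets 1" by (rule algebra_tree_sets)
  show "{P, {}} \<subseteq> algebra P hull tree_sets 1"
    using B.top B.empty_sets by simp
qed

text \<open>It suffices to place the generators: each is a finite union of trees of the refining
  \<open>H\<close>. If no branching has \<open>k\<close> roots, there is nothing to place.\<close>

lemma hull_tree_sets_Suc:
  assumes "k < card P"
  shows "algebra P hull tree_sets k \<subseteq> algebra P hull tree_sets (Suc k)"
proof (rule hull_minimal)
  interpret B: algebra P "algebra P hull tree_sets (Suc k)" by (rule algebra_tree_sets)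
  show "algebra P (algebra P hull tree_sets (Suc k))" by (rule algebra_tree_sets)
  show "tree_sets k \<subseteq> algebra P hull tree_sets (Suc k)"
  proof
    fix S assume S: "S \<in> tree_sets k"
    then obtain F r where F: "F \<in> min_branchings k" "r \<in> roots P F" "S = tree_of F r"
      by (auto simp: tree_sets_def)
    obtain H where H: "H \<in> min_branchings (Suc k)" "saturated H S"
      using refinement[OF F(1) assms] F(2,3) by metis
    have "S = (\<Union>s\<in>S \<inter> roots P H. tree_of H s)"
      using H S tree_sets_subset fin
      by (intro saturated_eq_Union_trees) (auto simp: min_branchings_def dest: branchingsD)
    also have "\<dots> \<in> algebra P hull tree_sets (Suc k)"
    proof (intro B.finite_UN)
      show "finite (S \<inter> roots P H)" by (simp add: finite_roots fin)
      fix s assume "s \<in> S \<inter> roots P H"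
      then have "tree_of H s \<in> tree_sets (Suc k)" using H(1) by (auto simp: tree_sets_def)
      then show "tree_of H s \<in> algebra P hull tree_sets (Suc k)" by (rule hull_inc)
    qed
    finally show "S \<in> algebra P hull tree_sets (Suc k)" .
  qed
qed

text \<open>When every vertex is a root there are no arcs, so the empty relation is the only
  candidate; its trees are the singletons, which generate all subsets of the finite set
  \<open>P\<close>.\<close>

lemma hull_tree_sets_card: "algebra P hull tree_sets (card P) = Pow P"
proof
  show "algebra P hull tree_sets (card P) \<subseteq> Pow P"
    by (intro hull_minimal tree_sets_subset algebra_Pow)
  have "R = {}" if "R \<in> branchings (card P)" for R
  proof -
    note RD = branchingsD[OF that]
    have "roots P R = P" using RD(3) fin roots_subset by (metis card_subset_eq)
    with RD(1) show ?thesis by (auto simp: roots_def branching_def)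
  qed
  moreover have "{} \<in> branchings (card P)"
    by (simp add: branchings_def branching_def roots_def acyclic_def)
  ultimately have "min_branchings (card P) = {{}}"
    by (auto simp: min_branchings_def)
  then have gen: "{x} \<in> tree_sets (card P)" if "x \<in> P" for x
    using that by (auto simp: tree_sets_def roots_def tree_of_def)
  interpret B: algebra P "algebra P hull tree_sets (card P)" by (rule algebra_tree_sets)
  show "Pow P \<subseteq> algebra P hull tree_sets (card P)"
  proof
    fix S assume S: "S \<in> Pow P"
    then have "(\<Union>x\<in>S. {x}) \<in> algebra P hull tree_sets (card P)"
      using fin gen by (intro B.finite_UN hull_inc) (auto intro: finite_subset)
    then show "S \<in> algebra P hull tree_sets (card P)" by simp
  qed
qed

end

theorem theorem2:
  fixes V :: "nat pair_pre_digraph"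
    and v :: "nat \<Rightarrow> nat \<Rightarrow> real"
    and N :: nat
  assumes "N \<ge> 1"
    and "pair_wf_digraph V"
    and "pverts V = {1..N}"
  shows "forest_algebra V v 1 = {{1..N}, {}}
    \<and> (\<forall>k\<in>{1..<N}. forest_algebra V v k \<subseteq> forest_algebra V v (k + 1))
    \<and> forest_algebra V v N = Pow {1..N}"
proof -
  have fin: "finite (pverts V)" using assms(3) by simp
  interpret weighted_arcs "pverts V" "parcs V" v
    using assms(2) fin by unfold_locales (auto simp: pair_wf_digraph_def)
  note eq = forest_algebra_eq_hull[OF assms(2) fin]
  have "card (pverts V) = N" "pverts V \<noteq> {}" using assms(1,3) by auto
  then show ?thesis
    using hull_tree_sets_1 hull_tree_sets_Suc hull_tree_sets_card by (simp add: eq assms(3))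
qed

end
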